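(* Let $\Sigma$ be a many-sorted first-order signature split by $\Lambda$ into $\{\Sigma_\lambda:\lambda\in\Lambda\}$. Let $\mathbb{A}$ be a $\Sigma$-structure; for each $\lambda\in\Lambda$ let $\kappa_\lambda$ be a cardinal with $\max\{\aleph_0,|\Sigma_\lambda|\}\le\kappa_\lambda\le\min\{|\sigma^{\mathbb{A}}|:\sigma\in\mathcal{S}^{\ge}_{\mathbb{A}}(\lambda)\}$, and for each $\sigma\in\mathcal{S}^{\ge}_{\mathbb{A}}(\lambda)$ let $A_\sigma\subseteq\sigma^{\mathbb{A}}$ with $|A_\sigma|\le\kappa_\lambda$. Then there is an elementary substructure $\mathbb{B}$ of $\mathbb{A}$ with $|\sigma^{\mathbb{B}}|=\kappa_\lambda$ and $\sigma^{\mathbb{B}}\supseteq A_\sigma$ for every $\lambda\in\Lambda$ and $\sigma\in\mathcal{S}^{\ge}_{\mathbb{A}}(\lambda)$, and $\sigma^{\mathbb{B}}=\sigma^{\mathbb{A}}$ for every $\sigma\in\mathcal{S}^{<}_{\mathbb{A}}$.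
   Context: Many-sorted first-order logic: a signature $\Sigma$ has a nonempty set $\mathcal{S}_\Sigma$ of sorts, a set $\mathcal{F}_\Sigma$ of function symbols and a set $\mathcal{P}_\Sigma$ of predicate symbols (including an equality symbol for each sort), with sorted arities; $|\Sigma|=|\mathcal{S}_\Sigma|+|\mathcal{F}_\Sigma|+|\mathcal{P}_\Sigma|$. A $\Sigma$-structure interprets each sort $\sigma$ as a nonempty set $\sigma^{\mathbb{A}}$. $\mathbb{A}$ is an elementary substructure of $\mathbb{B}$ if it is a substructure and for all formulas $\varphi$ and assignments $\nu$ into $\mathbb{A}$, $(\mathbb{A},\nu)\models\varphi$ iff $(\mathbb{B},\nu)\models\varphi$. $\Sigma$ is split by $\Lambda$ into signatures $\{\Sigma_\lambda:\lambda\in\Lambda\}$ if $\Lambda$ is a partition of $\mathcal{S}_\Sigma$, each $\Sigma_\lambda$ is a signature with sort set $\lambda$, $\mathcal{F}_\Sigma=\bigcup_\lambda\mathcal{F}_{\Sigma_\lambda}$ and $\mathcal{P}_\Sigma=\bigcup_\lambda\mathcal{P}_{\Sigma_\lambda}$. For a structure $\mathbb{A}$, $\mathcal{S}^{\ge}_{\mathbb{A}}=\{\sigma:|\sigma^{\mathbb{A}}|\ge\aleph_0\}$, $\mathcal{S}^{<}_{\mathbb{A}}=\mathcal{S}_\Sigma\setminus\mathcal{S}^{\ge}_{\mathbb{A}}$, and $\mathcal{S}^{\ge}_{\mathbb{A}}(\lambda)=\mathcal{S}^{\ge}_{\mathbb{A}}\cap\lambda$. *)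

theory Defs
  imports Main "HOL-Library.Disjoint_Sets"
begin

unbundle cardinal_syntax

text \<open>
  The arity of a function symbol \<open>f\<close> is the list \<open>fun_dom \<Sigma> f\<close> of argument sorts together
  with the result sort \<open>fun_cod \<Sigma> f\<close>; constants and nullary predicate symbols are allowed.
  Equality is not a logical primitive: \<open>eq_sym \<Sigma> \<sigma>\<close> is one of the predicate symbols, so
  equality symbols count towards the cardinality of \<open>\<Sigma>\<close>.
\<close>

record ('s, 'f, 'p) msig =
  sorts :: "'s set"
  funs :: "'f set"
  preds :: "'p set"
  fun_dom :: "'f \<Rightarrow> 's list"
  fun_cod :: "'f \<Rightarrow> 's"
  pred_dom :: "'p \<Rightarrow> 's list"
  eq_sym :: "'s \<Rightarrow> 'p"

definition is_signature :: "('s, 'f, 'p) msig \<Rightarrow> bool" where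
  "is_signature \<Sigma> \<longleftrightarrow>
     sorts \<Sigma> \<noteq> {} \<and>
     (\<forall>f\<in>funs \<Sigma>. set (fun_dom \<Sigma> f) \<subseteq> sorts \<Sigma> \<and> fun_cod \<Sigma> f \<in> sorts \<Sigma>) \<and>
     (\<forall>p\<in>preds \<Sigma>. set (pred_dom \<Sigma> p) \<subseteq> sorts \<Sigma>) \<and>
     (\<forall>\<sigma>\<in>sorts \<Sigma>. eq_sym \<Sigma> \<sigma> \<in> preds \<Sigma> \<and> pred_dom \<Sigma> (eq_sym \<Sigma> \<sigma>) = [\<sigma>, \<sigma>])"

definition sig_card :: "('s, 'f, 'p) msig \<Rightarrow> ('s + 'f + 'p) rel" where
  "sig_card \<Sigma> = |sorts \<Sigma>| +c |funs \<Sigma>| +c |preds \<Sigma>|"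

text \<open>Symbols of a subsignature keep their arities, and equality symbols are the same ones.\<close>

definition subsignature :: "('s, 'f, 'p) msig \<Rightarrow> ('s, 'f, 'p) msig \<Rightarrow> bool" where
  "subsignature \<Sigma>' \<Sigma> \<longleftrightarrow>
     sorts \<Sigma>' \<subseteq> sorts \<Sigma> \<and> funs \<Sigma>' \<subseteq> funs \<Sigma> \<and> preds \<Sigma>' \<subseteq> preds \<Sigma> \<and>
     (\<forall>f\<in>funs \<Sigma>'. fun_dom \<Sigma>' f = fun_dom \<Sigma> f \<and> fun_cod \<Sigma>' f = fun_cod \<Sigma> f) \<and>
     (\<forall>p\<in>preds \<Sigma>'. pred_dom \<Sigma>' p = pred_dom \<Sigma> p) \<and>
     (\<forall>\<sigma>\<in>sorts \<Sigma>'. eq_sym \<Sigma>' \<sigma> = eq_sym \<Sigma> \<sigma>)"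

text \<open>
  The unions below are not required to be disjoint. Since each part is a signature on its own
  sorts, only nullary predicate symbols can in fact belong to several parts.
\<close>

definition split_into ::
  "('s, 'f, 'p) msig \<Rightarrow> 's set set \<Rightarrow> ('s set \<Rightarrow> ('s, 'f, 'p) msig) \<Rightarrow> bool" where
  "split_into \<Sigma> \<Lambda> \<Sigma>s \<longleftrightarrow>
     partition_on (sorts \<Sigma>) \<Lambda> \<and>
     (\<forall>l\<in>\<Lambda>. is_signature (\<Sigma>s l) \<and> sorts (\<Sigma>s l) = l \<and> subsignature (\<Sigma>s l) \<Sigma>) \<and>
     funs \<Sigma> = (\<Union>l\<in>\<Lambda>. funs (\<Sigma>s l)) \<and>
     preds \<Sigma> = (\<Union>l\<in>\<Lambda>. preds (\<Sigma>s l))"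


text \<open>The variables of sort \<open>\<sigma>\<close> are the pairs \<open>(\<sigma>, n)\<close>.\<close>

type_synonym 's var = "'s \<times> nat"

datatype ('s, 'f) tm = Var "'s var" | Fn 'f "('s, 'f) tm list"

datatype ('s, 'f, 'p) fm =
    Atom 'p "('s, 'f) tm list"
  | Neg "('s, 'f, 'p) fm"
  | Conj "('s, 'f, 'p) fm" "('s, 'f, 'p) fm"
  | Disj "('s, 'f, 'p) fm" "('s, 'f, 'p) fm"
  | Imp "('s, 'f, 'p) fm" "('s, 'f, 'p) fm"
  | Forall "'s var" "('s, 'f, 'p) fm"
  | Exists "'s var" "('s, 'f, 'p) fm"

inductive is_term :: "('s, 'f, 'p) msig \<Rightarrow> ('s, 'f) tm \<Rightarrow> 's \<Rightarrow> bool" for \<Sigma> where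
  "\<sigma> \<in> sorts \<Sigma> \<Longrightarrow> is_term \<Sigma> (Var (\<sigma>, n)) \<sigma>"
| "f \<in> funs \<Sigma> \<Longrightarrow> list_all2 (is_term \<Sigma>) ts (fun_dom \<Sigma> f) \<Longrightarrow> is_term \<Sigma> (Fn f ts) (fun_cod \<Sigma> f)"

primrec is_formula :: "('s, 'f, 'p) msig \<Rightarrow> ('s, 'f, 'p) fm \<Rightarrow> bool" where
  "is_formula \<Sigma> (Atom p ts) \<longleftrightarrow> p \<in> preds \<Sigma> \<and> list_all2 (is_term \<Sigma>) ts (pred_dom \<Sigma> p)"
| "is_formula \<Sigma> (Neg \<phi>) \<longleftrightarrow> is_formula \<Sigma> \<phi>"
| "is_formula \<Sigma> (Conj \<phi> \<psi>) \<longleftrightarrow> is_formula \<Sigma> \<phi> \<and> is_formula \<Sigma> \<psi>"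
| "is_formula \<Sigma> (Disj \<phi> \<psi>) \<longleftrightarrow> is_formula \<Sigma> \<phi> \<and> is_formula \<Sigma> \<psi>"
| "is_formula \<Sigma> (Imp \<phi> \<psi>) \<longleftrightarrow> is_formula \<Sigma> \<phi> \<and> is_formula \<Sigma> \<psi>"
| "is_formula \<Sigma> (Forall x \<phi>) \<longleftrightarrow> fst x \<in> sorts \<Sigma> \<and> is_formula \<Sigma> \<phi>"
| "is_formula \<Sigma> (Exists x \<phi>) \<longleftrightarrow> fst x \<in> sorts \<Sigma> \<and> is_formula \<Sigma> \<phi>"


text \<open>
  All carriers live in one type \<open>'a\<close>; they need not be disjoint for different sorts.
  The values of \<open>fun_int\<close> and \<open>pred_int\<close> on ill-sorted argument lists, and of \<open>carrier\<close> outside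
  the sorts of the signature, are irrelevant.
\<close>

record ('s, 'f, 'p, 'a) mstruct =
  carrier :: "'s \<Rightarrow> 'a set"
  fun_int :: "'f \<Rightarrow> 'a list \<Rightarrow> 'a"
  pred_int :: "'p \<Rightarrow> 'a list \<Rightarrow> bool"

definition tuples :: "('s, 'f, 'p, 'a) mstruct \<Rightarrow> 's list \<Rightarrow> 'a list set" where
  "tuples \<AA> \<sigma>s = {as. list_all2 (\<lambda>a \<sigma>. a \<in> carrier \<AA> \<sigma>) as \<sigma>s}"

definition is_structure :: "('s, 'f, 'p) msig \<Rightarrow> ('s, 'f, 'p, 'a) mstruct \<Rightarrow> bool" where
  "is_structure \<Sigma> \<AA> \<longleftrightarrow>
     (\<forall>\<sigma>\<in>sorts \<Sigma>. carrier \<AA> \<sigma> \<noteq> {}) \<and>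
     (\<forall>f\<in>funs \<Sigma>. \<forall>as\<in>tuples \<AA> (fun_dom \<Sigma> f). fun_int \<AA> f as \<in> carrier \<AA> (fun_cod \<Sigma> f)) \<and>
     (\<forall>\<sigma>\<in>sorts \<Sigma>. \<forall>a\<in>carrier \<AA> \<sigma>. \<forall>b\<in>carrier \<AA> \<sigma>. pred_int \<AA> (eq_sym \<Sigma> \<sigma>) [a, b] \<longleftrightarrow> a = b)"

definition is_assignment ::
  "('s, 'f, 'p) msig \<Rightarrow> ('s, 'f, 'p, 'a) mstruct \<Rightarrow> ('s var \<Rightarrow> 'a) \<Rightarrow> bool" where
  "is_assignment \<Sigma> \<AA> \<nu> \<longleftrightarrow> (\<forall>\<sigma>\<in>sorts \<Sigma>. \<forall>n. \<nu> (\<sigma>, n) \<in> carrier \<AA> \<sigma>)"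

primrec tm_val :: "('s, 'f, 'p, 'a) mstruct \<Rightarrow> ('s var \<Rightarrow> 'a) \<Rightarrow> ('s, 'f) tm \<Rightarrow> 'a" where
  "tm_val \<AA> \<nu> (Var x) = \<nu> x"
| "tm_val \<AA> \<nu> (Fn f ts) = fun_int \<AA> f (map (tm_val \<AA> \<nu>) ts)"

primrec sat :: "('s, 'f, 'p, 'a) mstruct \<Rightarrow> ('s var \<Rightarrow> 'a) \<Rightarrow> ('s, 'f, 'p) fm \<Rightarrow> bool" where
  "sat \<AA> \<nu> (Atom p ts) \<longleftrightarrow> pred_int \<AA> p (map (tm_val \<AA> \<nu>) ts)"
| "sat \<AA> \<nu> (Neg \<phi>) \<longleftrightarrow> \<not> sat \<AA> \<nu> \<phi>"
| "sat \<AA> \<nu> (Conj \<phi> \<psi>) \<longleftrightarrow> sat \<AA> \<nu> \<phi> \<and> sat \<AA> \<nu> \<psi>"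
| "sat \<AA> \<nu> (Disj \<phi> \<psi>) \<longleftrightarrow> sat \<AA> \<nu> \<phi> \<or> sat \<AA> \<nu> \<psi>"
| "sat \<AA> \<nu> (Imp \<phi> \<psi>) \<longleftrightarrow> (sat \<AA> \<nu> \<phi> \<longrightarrow> sat \<AA> \<nu> \<psi>)"
| "sat \<AA> \<nu> (Forall x \<phi>) \<longleftrightarrow> (\<forall>a\<in>carrier \<AA> (fst x). sat \<AA> (\<nu>(x := a)) \<phi>)"
| "sat \<AA> \<nu> (Exists x \<phi>) \<longleftrightarrow> (\<exists>a\<in>carrier \<AA> (fst x). sat \<AA> (\<nu>(x := a)) \<phi>)"

definition substructure ::
  "('s, 'f, 'p) msig \<Rightarrow> ('s, 'f, 'p, 'a) mstruct \<Rightarrow> ('s, 'f, 'p, 'a) mstruct \<Rightarrow> bool" where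
  "substructure \<Sigma> \<BB> \<AA> \<longleftrightarrow>
     is_structure \<Sigma> \<BB> \<and> is_structure \<Sigma> \<AA> \<and>
     (\<forall>\<sigma>\<in>sorts \<Sigma>. carrier \<BB> \<sigma> \<subseteq> carrier \<AA> \<sigma>) \<and>
     (\<forall>f\<in>funs \<Sigma>. \<forall>as\<in>tuples \<BB> (fun_dom \<Sigma> f). fun_int \<BB> f as = fun_int \<AA> f as) \<and>
     (\<forall>p\<in>preds \<Sigma>. \<forall>as\<in>tuples \<BB> (pred_dom \<Sigma> p). pred_int \<BB> p as \<longleftrightarrow> pred_int \<AA> p as)"

definition elementary_substructure ::
  "('s, 'f, 'p) msig \<Rightarrow> ('s, 'f, 'p, 'a) mstruct \<Rightarrow> ('s, 'f, 'p, 'a) mstruct \<Rightarrow> bool" where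
  "elementary_substructure \<Sigma> \<BB> \<AA> \<longleftrightarrow>
     substructure \<Sigma> \<BB> \<AA> \<and>
     (\<forall>\<phi> \<nu>. is_formula \<Sigma> \<phi> \<longrightarrow> is_assignment \<Sigma> \<BB> \<nu> \<longrightarrow> (sat \<BB> \<nu> \<phi> \<longleftrightarrow> sat \<AA> \<nu> \<phi>))"

definition inf_sorts :: "('s, 'f, 'p) msig \<Rightarrow> ('s, 'f, 'p, 'a) mstruct \<Rightarrow> 's set" where
  "inf_sorts \<Sigma> \<AA> = {\<sigma> \<in> sorts \<Sigma>. natLeq \<le>o |carrier \<AA> \<sigma>|}"

definition fin_sorts :: "('s, 'f, 'p) msig \<Rightarrow> ('s, 'f, 'p, 'a) mstruct \<Rightarrow> 's set" where
  "fin_sorts \<Sigma> \<AA> = sorts \<Sigma> - inf_sorts \<Sigma> \<AA>"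

end

theory Submission imports Defs begin

text \<open>
  Each part \<open>\<Sigma>s l\<close> has at most \<open>\<kappa> l\<close> formulas, so a Skolem hull inside the \<open>\<Sigma>s l\<close>-reduct of \<open>\<AA>\<close>,
  started from suitable sets of size at most \<open>\<kappa> l\<close>, gives an elementary substructure of that
  reduct. A single hull for \<open>\<Sigma>\<close> would not do, as \<open>\<Sigma>\<close> may have more than \<open>\<kappa> l\<close> formulas. The union of
  the hulls is elementary for all of \<open>\<Sigma>\<close> because, in the manner of Feferman and Vaught, the truth
  of a \<open>\<Sigma>\<close>-formula is determined by the truth of finitely many formulas, each over a single part.
\<close>

section \<open>Closure of a set under operations on lists\<close>

text \<open>An operation takes lists of any length, so one inductive set serves all arities at once.
  Lists of the wrong length are fed in too; this can only enlarge the closure and does no harm to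
  upper bounds on its size.\<close>

inductive_set closure :: "('b list \<Rightarrow> 'b) set \<Rightarrow> 'b set \<Rightarrow> 'b set" for G X where
  base: "x \<in> X \<Longrightarrow> x \<in> closure G X"
| step: "g \<in> G \<Longrightarrow> xs \<in> lists (closure G X) \<Longrightarrow> g xs \<in> closure G X"

text \<open>Case analysis suffices in place of induction, because the second assumption asks for
  values in \<open>Y\<close> on all lists, not only on lists over \<open>Y\<close>. The functions
  \<open>skolem\<close> and \<open>sorted_app\<close> are made total so as to meet it.\<close>

lemma closure_subset:
  assumes "X \<subseteq> Y" "\<And>g xs. g \<in> G \<Longrightarrow> g xs \<in> Y"
  shows "closure G X \<subseteq> Y"
proof
  fix x assume "x \<in> closure G X"
  then show "x \<in> Y" by cases (use assms in auto)
qed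

text \<open>A list has finitely many entries, so along an increasing chain they all lie in one
  stage.\<close>

lemma lists_UN_mono:
  fixes S :: "nat \<Rightarrow> 'b set"
  assumes "mono S"
  shows "lists (\<Union>n. S n) = (\<Union>n. lists (S n))"
proof (intro equalityI subsetI)
  fix xs assume "xs \<in> lists (\<Union>n. S n)"
  then have "\<exists>n. xs \<in> lists (S n)"
  proof (induction xs)
    case (Cons x xs)
    then obtain m n where "xs \<in> lists (S n)" "x \<in> S m" by auto
    moreover have "S m \<subseteq> S (max m n)" "S n \<subseteq> S (max m n)"
      by (rule monoD[OF assms], simp)+
    ultimately have "x # xs \<in> lists (S (max m n))" by auto
    then show ?case ..
  qed auto
  then show "xs \<in> (\<Union>n. lists (S n))" by auto
qed auto

section \<open>Sets of size at most a given infinite cardinal\<close>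

lemma infinite_Field:
  assumes "Card_order r" "natLeq \<le>o r"
  shows "infinite (Field r)"
proof -
  have "natLeq \<le>o |Field r|"
    using assms card_of_Field_ordIso ordIso_symmetric ordLeq_ordIso_trans by blast
  then show ?thesis using infinite_iff_natLeq_ordLeq by blast
qed

lemma subset_ordLeq: "A \<subseteq> B \<Longrightarrow> |B| \<le>o r \<Longrightarrow> |A| \<le>o r"
  by (rule ordLeq_transitive[OF card_of_mono1])

context
  fixes r :: "'k rel"
  assumes card: "Card_order r" and inf: "infinite (Field r)"
begin

lemma countable_ordLeq: "|A :: 'n set| \<le>o r" if "|A| \<le>o natLeq"
proof -
  have "natLeq \<le>o |Field r|"
    using inf infinite_iff_natLeq_ordLeq by blast
  then have "natLeq \<le>o r"
    using card card_of_Field_ordIso ordLeq_ordIso_trans by blast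
  then show ?thesis
    using that ordLeq_transitive by blast
qed

lemma finite_set_ordLeq:
  assumes "finite A"
  shows "|A| \<le>o r"
proof -
  have "|A| <o |Field r|" using assms inf
    by (intro finite_ordLess_infinite card_of_Well_order) (simp_all add: Field_card_of)
  then show ?thesis
    using card_of_Field_ordIso[OF card] ordLess_imp_ordLeq ordLeq_ordIso_trans by blast
qed

lemma nat_set_ordLeq: "|A :: nat set| \<le>o r"
  by (rule countable_ordLeq) (rule ordLeq_ordIso_trans[OF card_of_mono1[OF subset_UNIV] card_of_nat])

lemma image_ordLeq: "|A| \<le>o r \<Longrightarrow> |f ` A| \<le>o r"
  by (rule ordLeq_transitive[OF card_of_image])

lemma Times_ordLeq: "|A| \<le>o r \<Longrightarrow> |B| \<le>o r \<Longrightarrow> |A \<times> B| \<le>o r"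
  using card inf by (rule card_of_Times_ordLeq_infinite_Field[rotated -1])

lemma Un_ordLeq: "|A| \<le>o r \<Longrightarrow> |B| \<le>o r \<Longrightarrow> |A \<union> B| \<le>o r"
  using card inf by (rule card_of_Un_ordLeq_infinite_Field[rotated -1])

text \<open>Lists of length \<open>Suc n\<close> arise from pairs of an entry and a list of length
  \<open>n\<close>, and an infinite cardinal absorbs finite products and countable unions.\<close>

lemma lists_ordLeq:
  assumes "|A| \<le>o r"
  shows "|lists A| \<le>o r"
proof -
  have "|{xs \<in> lists A. length xs = n}| \<le>o r" for n
  proof (induction n)
    case 0
    have "finite {xs \<in> lists A. length xs = 0}" by (rule finite_subset[of _ "{[]}"]) auto
    then show ?case by (rule finite_set_ordLeq)
  next
    case (Suc n)
    have "{xs \<in> lists A. length xs = Suc n} \<subseteq>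
        (\<lambda>(x, xs). x # xs) ` (A \<times> {xs \<in> lists A. length xs = n})" (is "?L \<subseteq> ?R")
    proof
      fix ys assume "ys \<in> ?L"
      then show "ys \<in> ?R" by (cases ys) auto
    qed
    then show ?case by (rule subset_ordLeq) (rule image_ordLeq[OF Times_ordLeq[OF assms Suc]])
  qed
  then have "|\<Union>n. {xs \<in> lists A. length xs = n}| \<le>o r"
    by (intro card_of_UNION_ordLeq_infinite_Field[OF inf card] nat_set_ordLeq ballI)
  moreover have "(\<Union>n. {xs \<in> lists A. length xs = n}) = lists A" by auto
  ultimately show ?thesis by simp
qed

text \<open>The closure is exhausted by countably many stages \<open>S n\<close>. Each stage adds
  one round of values, indexed by pairs of an operation and a list over the previous stage.\<close>

lemma closure_ordLeq:
  assumes "|G| \<le>o r" "|X| \<le>o r"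
  shows "|closure G X| \<le>o r"
proof -
  define S where "S = rec_nat X (\<lambda>_ Y. Y \<union> (\<lambda>(g, xs). g xs) ` (G \<times> lists Y))"
  have S0: "S 0 = X" and SS: "S (Suc n) = S n \<union> (\<lambda>(g, xs). g xs) ` (G \<times> lists (S n))" for n
    by (simp_all add: S_def)
  have "mono S" by (rule mono_iff_le_Suc[THEN iffD2]) (simp add: SS)
  have "|S n| \<le>o r" for n
  proof (induction n)
    case 0
    show ?case unfolding S0 by (rule assms(2))
  next
    case (Suc n)
    then show ?case
      unfolding SS by (intro Un_ordLeq image_ordLeq Times_ordLeq lists_ordLeq assms(1))
  qed
  then have "|\<Union>n. S n| \<le>o r"
    by (intro card_of_UNION_ordLeq_infinite_Field[OF inf card] nat_set_ordLeq ballI)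
  moreover have "closure G X \<subseteq> (\<Union>n. S n)"
  proof
    fix x assume "x \<in> closure G X"
    then show "x \<in> (\<Union>n. S n)"
    proof induction
      case (base x)
      then have "x \<in> S 0" by (simp only: S0)
      then show ?case by blast
    next
      case (step g xs)
      then have "xs \<in> lists (\<Union>n. S n)" by auto
      then obtain n where "xs \<in> lists (S n)"
        unfolding lists_UN_mono[OF \<open>mono S\<close>] by auto
      with step(1) have "(g, xs) \<in> G \<times> lists (S n)" by simp
      then have "g xs \<in> S (Suc n)" unfolding SS by (intro UnI2 image_eqI[of _ _ "(g, xs)"]) simp_all
      then show ?case by blast
    qed
  qed
  ultimately show ?thesis by (rule subset_ordLeq[rotated])
qed

section \<open>Counting terms and formulas\<close>

text \<open>Arities are ignored in the count: the closure of the variables under all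
  \<open>Fn f\<close> contains every well-sorted term.\<close>

lemma terms_ordLeq:
  assumes "|sorts \<Sigma>| \<le>o r" "|funs \<Sigma>| \<le>o r"
  shows "|{t. \<exists>\<sigma>. is_term \<Sigma> t \<sigma>}| \<le>o r"
proof -
  let ?C = "closure (Fn ` funs \<Sigma>) (Var ` (sorts \<Sigma> \<times> UNIV))"
  have "t \<in> ?C" if "is_term \<Sigma> t \<sigma>" for t \<sigma>
    using that
  proof induction
    case (1 \<sigma> n)
    then show ?case by (auto intro: closure.base)
  next
    case (2 f ts)
    then have "ts \<in> lists ?C"
      by (auto simp: list_all2_conv_all_nth in_set_conv_nth)
    with 2 show ?case by (auto intro: closure.step)
  qed
  then have "{t. \<exists>\<sigma>. is_term \<Sigma> t \<sigma>} \<subseteq> ?C" by auto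
  moreover have "|?C| \<le>o r"
    by (intro closure_ordLeq image_ordLeq Times_ordLeq nat_set_ordLeq assms)
  ultimately show ?thesis by (rule subset_ordLeq)
qed

text \<open>Connectives and quantifiers become operations on lists that read entries 0 and 1. On
  shorter lists \<open>!\<close> gives unspecified formulas, which is harmless for an upper bound.
  Each variable contributes its own two quantifier operations.\<close>

lemma formulas_ordLeq:
  fixes \<Sigma> :: "('s, 'f, 'p) msig"
  assumes "|sorts \<Sigma>| \<le>o r" "|funs \<Sigma>| \<le>o r" "|preds \<Sigma>| \<le>o r"
  shows "|{\<phi>. is_formula \<Sigma> \<phi>}| \<le>o r"
proof -
  let ?T = "{t. \<exists>\<sigma>. is_term \<Sigma> t \<sigma>}"
  let ?X = "(\<lambda>(p, ts). Atom p ts) ` (preds \<Sigma> \<times> lists ?T)"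
  let ?B = "{\<lambda>\<phi>s. Neg (\<phi>s ! 0), \<lambda>\<phi>s. Conj (\<phi>s ! 0) (\<phi>s ! 1), \<lambda>\<phi>s. Disj (\<phi>s ! 0) (\<phi>s ! 1),
    \<lambda>\<phi>s. Imp (\<phi>s ! 0) (\<phi>s ! 1)} :: (('s, 'f, 'p) fm list \<Rightarrow> ('s, 'f, 'p) fm) set"
  let ?G = "?B \<union> ((\<lambda>x \<phi>s. Forall x (\<phi>s ! 0)) ` (sorts \<Sigma> \<times> UNIV) \<union>
    (\<lambda>x \<phi>s. Exists x (\<phi>s ! 0)) ` (sorts \<Sigma> \<times> UNIV))"
  let ?C = "closure ?G ?X"
  have step1: "\<phi> \<in> ?C" if "g \<in> ?G" "\<phi> = g [\<psi>]" "\<psi> \<in> ?C" for \<phi> \<psi> g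
    using closure.step[OF that(1), of "[\<psi>]" ?X] that(2,3) by simp
  have step2: "\<phi> \<in> ?C" if "g \<in> ?G" "\<phi> = g [\<psi>, \<chi>]" "\<psi> \<in> ?C" "\<chi> \<in> ?C" for \<phi> \<psi> \<chi> g
    using closure.step[OF that(1), of "[\<psi>, \<chi>]" ?X] that(2-4) by simp
  have "\<phi> \<in> ?C" if "is_formula \<Sigma> \<phi>" for \<phi>
    using that
  proof (induction \<phi>)
    case (Atom p ts)
    have "\<exists>\<sigma>. is_term \<Sigma> t \<sigma>" if "t \<in> set ts" for t
      using Atom that by (auto simp: list_all2_conv_all_nth in_set_conv_nth)
    then have "ts \<in> lists ?T" by auto
    with Atom show ?case by (auto intro!: closure.base)
  next
    case (Neg \<phi>)
    have "(\<lambda>\<phi>s. Neg (\<phi>s ! 0)) \<in> ?G" by blast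
    then show ?case by (rule step1[where \<psi> = \<phi>]) (use Neg in simp_all)
  next
    case (Conj \<phi> \<psi>)
    have "(\<lambda>\<phi>s. Conj (\<phi>s ! 0) (\<phi>s ! 1)) \<in> ?G" by blast
    then show ?case by (rule step2[where \<psi> = \<phi> and \<chi> = \<psi>]) (use Conj in simp_all)
  next
    case (Disj \<phi> \<psi>)
    have "(\<lambda>\<phi>s. Disj (\<phi>s ! 0) (\<phi>s ! 1)) \<in> ?G" by blast
    then show ?case by (rule step2[where \<psi> = \<phi> and \<chi> = \<psi>]) (use Disj in simp_all)
  next
    case (Imp \<phi> \<psi>)
    have "(\<lambda>\<phi>s. Imp (\<phi>s ! 0) (\<phi>s ! 1)) \<in> ?G" by blast
    then show ?case by (rule step2[where \<psi> = \<phi> and \<chi> = \<psi>]) (use Imp in simp_all)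
  next
    case (Forall x \<phi>)
    then have "x \<in> sorts \<Sigma> \<times> UNIV" by (simp add: mem_Times_iff)
    then have "(\<lambda>\<phi>s. Forall x (\<phi>s ! 0)) \<in> ?G" by blast
    then show ?case by (rule step1[where \<psi> = \<phi>]) (use Forall in simp_all)
  next
    case (Exists x \<phi>)
    then have "x \<in> sorts \<Sigma> \<times> UNIV" by (simp add: mem_Times_iff)
    then have "(\<lambda>\<phi>s. Exists x (\<phi>s ! 0)) \<in> ?G" by blast
    then show ?case by (rule step1[where \<psi> = \<phi>]) (use Exists in simp_all)
  qed
  then have "{\<phi>. is_formula \<Sigma> \<phi>} \<subseteq> ?C" by auto
  moreover have "|?B| \<le>o r" by (rule finite_set_ordLeq) simp
  then have "|?C| \<le>o r"
    by (intro closure_ordLeq Un_ordLeq image_ordLeq Times_ordLeq lists_ordLeq terms_ordLeq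
        nat_set_ordLeq assms)
  ultimately show ?thesis by (rule subset_ordLeq)
qed

end

section \<open>Dependence of truth on carriers and on variables\<close>

lemma tm_val_carrier_update [simp]: "tm_val (M\<lparr>carrier := C\<rparr>) \<nu> t = tm_val M \<nu> t"
  by (induction t) (simp_all cong: map_cong)

text \<open>Every quantifier in a formula over \<open>\<Sigma>\<close> ranges over a sort of
  \<open>\<Sigma>\<close>. This later allows the hull of one part to be exchanged for the glued
  carriers, which agree with it on the sorts of that part.\<close>

lemma sat_carrier_cong:
  assumes "is_formula \<Sigma> \<phi>" "\<And>\<sigma>. \<sigma> \<in> sorts \<Sigma> \<Longrightarrow> C \<sigma> = D \<sigma>"
  shows "sat (M\<lparr>carrier := C\<rparr>) \<nu> \<phi> = sat (M\<lparr>carrier := D\<rparr>) \<nu> \<phi>"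
  using assms(1)
proof (induction \<phi> arbitrary: \<nu>)
  case (Atom p ts)
  have "tm_val (M\<lparr>carrier := C\<rparr>) \<nu> = tm_val (M\<lparr>carrier := D\<rparr>) \<nu>" by (rule ext) simp
  then show ?case by simp
qed (use assms(2) in auto)

lemma tm_val_finite_support:
  fixes t :: "('s, 'f) tm"
  assumes "is_term \<Sigma> t \<sigma>"
  shows "\<exists>V. finite V \<and> V \<subseteq> sorts \<Sigma> \<times> UNIV \<and>
    (\<forall>(M :: ('s, 'f, 'p, 'a) mstruct) \<mu> \<nu>.
      (\<forall>x\<in>V. \<mu> x = \<nu> x) \<longrightarrow> tm_val M \<mu> t = tm_val M \<nu> t)"
  using assms
proof induction
  case (1 \<sigma> n)
  then show ?case by (intro exI[of _ "{(\<sigma>, n)}"]) auto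
next
  case (2 f ts)
  define P :: "('s, 'f) tm \<Rightarrow> 's var set \<Rightarrow> bool" where "P t V \<longleftrightarrow> finite V \<and> V \<subseteq> sorts \<Sigma> \<times> UNIV \<and>
    (\<forall>(M :: ('s, 'f, 'p, 'a) mstruct) \<mu> \<nu>.
      (\<forall>x\<in>V. \<mu> x = \<nu> x) \<longrightarrow> tm_val M \<mu> t = tm_val M \<nu> t)" for t V
  have "\<forall>t\<in>set ts. \<exists>V. P t V"
    using 2(2) unfolding P_def by (auto simp: list_all2_conv_all_nth in_set_conv_nth)
  then obtain V where V: "\<And>t. t \<in> set ts \<Longrightarrow> P t (V t)" by metis
  show ?case
  proof (intro exI[of _ "\<Union>t\<in>set ts. V t"] conjI allI impI)
    fix M :: "('s, 'f, 'p, 'a) mstruct" and \<mu> \<nu> :: "'s var \<Rightarrow> 'a"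
    assume "\<forall>x\<in>\<Union>t\<in>set ts. V t. \<mu> x = \<nu> x"
    then have "map (tm_val M \<mu>) ts = map (tm_val M \<nu>) ts"
      using V unfolding P_def by (intro map_cong) auto
    then show "tm_val M \<mu> (Fn f ts) = tm_val M \<nu> (Fn f ts)"
      unfolding tm_val.simps by (rule arg_cong)
  qed (use V in \<open>auto simp: P_def\<close>)
qed

text \<open>Finiteness of \<open>V\<close> lets the argument list of a Skolem function carry all
  relevant values; the restriction on the sorts in \<open>V\<close> makes a formula insensitive to
  variables of foreign sorts. Bound variables may stay in \<open>V\<close>, so free variables need
  not be defined.\<close>

lemma sat_finite_support:
  assumes "is_formula \<Sigma> \<phi>"
  shows "\<exists>V. finite V \<and> V \<subseteq> sorts \<Sigma> \<times> UNIV \<and>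
    (\<forall>(M :: ('s, 'f, 'p, 'a) mstruct) \<mu> \<nu>.
      (\<forall>x\<in>V. \<mu> x = \<nu> x) \<longrightarrow> sat M \<mu> \<phi> = sat M \<nu> \<phi>)"
proof -
  define P where "P \<phi> V \<longleftrightarrow> finite V \<and> V \<subseteq> sorts \<Sigma> \<times> UNIV \<and>
    (\<forall>(M :: ('s, 'f, 'p, 'a) mstruct) \<mu> \<nu>.
      (\<forall>x\<in>V. \<mu> x = \<nu> x) \<longrightarrow> sat M \<mu> \<phi> = sat M \<nu> \<phi>)" for \<phi> V
  have join: "P \<chi> (V \<union> W)"
    if "P \<phi> V" "P \<psi> W" and \<chi>: "\<And>(M :: ('s, 'f, 'p, 'a) mstruct) \<mu> \<nu>.
      sat M \<mu> \<phi> = sat M \<nu> \<phi> \<Longrightarrow> sat M \<mu> \<psi> = sat M \<nu> \<psi> \<Longrightarrow> sat M \<mu> \<chi> = sat M \<nu> \<chi>"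
    for \<phi> \<psi> \<chi> V W
    unfolding P_def
  proof (intro conjI allI impI)
    fix M :: "('s, 'f, 'p, 'a) mstruct" and \<mu> \<nu> :: "'s var \<Rightarrow> 'a"
    assume "\<forall>x\<in>V \<union> W. \<mu> x = \<nu> x"
    then show "sat M \<mu> \<chi> = sat M \<nu> \<chi>"
      using that(1,2) by (intro \<chi>) (simp_all add: P_def ball_Un)
  qed (use that in \<open>auto simp: P_def\<close>)
  \<comment> \<open>Assignments that agree on \<open>V\<close> still do so after both receive the
    same value at \<open>x\<close>, so a quantifier leaves \<open>V\<close> unchanged.\<close>
  have quant: "P \<chi> V"
    if "P \<phi> V" and \<chi>: "\<And>(M :: ('s, 'f, 'p, 'a) mstruct) \<mu> \<nu>.
      (\<And>a. sat M (\<mu>(x := a)) \<phi> = sat M (\<nu>(x := a)) \<phi>) \<Longrightarrow> sat M \<mu> \<chi> = sat M \<nu> \<chi>"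
    for \<phi> \<chi> V x
    unfolding P_def
  proof (intro conjI allI impI)
    fix M :: "('s, 'f, 'p, 'a) mstruct" and \<mu> \<nu> :: "'s var \<Rightarrow> 'a"
    assume "\<forall>x\<in>V. \<mu> x = \<nu> x"
    then show "sat M \<mu> \<chi> = sat M \<nu> \<chi>"
      using that(1) by (intro \<chi>) (simp add: P_def)
  qed (use that in \<open>auto simp: P_def\<close>)
  have "\<exists>V. P \<phi> V"
    using assms
  proof (induction \<phi>)
    case (Atom p ts)
    define Q where "Q t V \<longleftrightarrow> finite V \<and> V \<subseteq> sorts \<Sigma> \<times> UNIV \<and>
      (\<forall>(M :: ('s, 'f, 'p, 'a) mstruct) \<mu> \<nu>.
        (\<forall>x\<in>V. \<mu> x = \<nu> x) \<longrightarrow> tm_val M \<mu> t = tm_val M \<nu> t)" for t V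
    have "\<forall>t\<in>set ts. \<exists>V. Q t V"
    proof
      fix t assume "t \<in> set ts"
      then obtain \<sigma> where "is_term \<Sigma> t \<sigma>"
        using Atom by (auto simp: list_all2_conv_all_nth in_set_conv_nth)
      then show "\<exists>V. Q t V" unfolding Q_def by (rule tm_val_finite_support)
    qed
    then obtain V where V: "\<And>t. t \<in> set ts \<Longrightarrow> Q t (V t)" by metis
    have "P (Atom p ts) (\<Union>t\<in>set ts. V t)"
      unfolding P_def
    proof (intro conjI allI impI)
      fix M :: "('s, 'f, 'p, 'a) mstruct" and \<mu> \<nu> :: "'s var \<Rightarrow> 'a"
      assume "\<forall>x\<in>\<Union>t\<in>set ts. V t. \<mu> x = \<nu> x"
      then have "map (tm_val M \<mu>) ts = map (tm_val M \<nu>) ts"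
        using V unfolding Q_def by (intro map_cong) auto
      then show "sat M \<mu> (Atom p ts) = sat M \<nu> (Atom p ts)"
        unfolding sat.simps by (rule arg_cong)
    qed (use V in \<open>auto simp: Q_def\<close>)
    then show ?case ..
  next
    case (Neg \<phi>)
    then obtain V where "P \<phi> V" by auto
    then have "P (Neg \<phi>) V" by (auto simp: P_def)
    then show ?case ..
  next
    case (Conj \<phi> \<psi>)
    then obtain V W where "P \<phi> V" "P \<psi> W" by auto
    then have "P (Conj \<phi> \<psi>) (V \<union> W)" by (rule join) simp
    then show ?case ..
  next
    case (Disj \<phi> \<psi>)
    then obtain V W where "P \<phi> V" "P \<psi> W" by auto
    then have "P (Disj \<phi> \<psi>) (V \<union> W)" by (rule join) simp
    then show ?case ..
  next
    case (Imp \<phi> \<psi>)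
    then obtain V W where "P \<phi> V" "P \<psi> W" by auto
    then have "P (Imp \<phi> \<psi>) (V \<union> W)" by (rule join) simp
    then show ?case ..
  next
    case (Forall x \<phi>)
    then obtain V where "P \<phi> V" by auto
    then have "P (Forall x \<phi>) V" by (rule quant[where x = x]) simp
    then show ?case ..
  next
    case (Exists x \<phi>)
    then obtain V where "P \<phi> V" by auto
    then have "P (Exists x \<phi>) V" by (rule quant[where x = x]) simp
    then show ?case ..
  qed
  then show ?thesis unfolding P_def .
qed

text \<open>The finite support consists of variables with sorts in \<open>\<Sigma>\<close>, so
  \<open>x\<close> is not among them.\<close>

lemma sat_upd_other_sort:
  assumes "is_formula \<Sigma> \<phi>" "fst x \<notin> sorts \<Sigma>"
  shows "sat M (\<nu>(x := a)) \<phi> = sat M \<nu> \<phi>"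
proof -
  obtain V where V: "V \<subseteq> sorts \<Sigma> \<times> UNIV"
    "\<And>\<mu> \<nu>. \<forall>x\<in>V. \<mu> x = \<nu> x \<Longrightarrow> sat M \<mu> \<phi> = sat M \<nu> \<phi>"
    using sat_finite_support[OF assms(1)] by metis
  have "\<forall>y\<in>V. (\<nu>(x := a)) y = \<nu> y" using V(1) assms(2) by auto
  then show ?thesis by (rule V(2))
qed

section \<open>Skolem functions and hulls within one signature\<close>

text \<open>
  Carriers of different sorts may overlap, so the hull is formed from pairs of a sort and an
  element. Both functions below are total with values of the right sort, even on ill-sorted
  argument lists, so that the hull stays inside the carriers.
\<close>

definition skolem ::
  "('s, 'f, 'p, 'a) mstruct \<Rightarrow> ('s, 'f, 'p) fm \<Rightarrow> 's var \<Rightarrow> 's var list \<Rightarrow> ('s \<times> 'a) list \<Rightarrow> 's \<times> 'a"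
  where
  "skolem \<AA> \<phi> x vs as = (fst x, SOME a. a \<in> carrier \<AA> (fst x) \<and>
    (let \<nu> = (\<lambda>v. the (map_of (zip vs (map snd as)) v)) in
      (\<exists>b\<in>carrier \<AA> (fst x). sat \<AA> (\<nu>(x := b)) \<phi>) \<longrightarrow> sat \<AA> (\<nu>(x := a)) \<phi>))"

definition sorted_app ::
  "('s, 'f, 'p) msig \<Rightarrow> ('s, 'f, 'p, 'a) mstruct \<Rightarrow> 'f \<Rightarrow> ('s \<times> 'a) list \<Rightarrow> 's \<times> 'a" where
  "sorted_app \<Sigma> \<AA> f as = (fun_cod \<Sigma> f, SOME a. a \<in> carrier \<AA> (fun_cod \<Sigma> f) \<and>
    (map snd as \<in> tuples \<AA> (fun_dom \<Sigma> f) \<longrightarrow> a = fun_int \<AA> f (map snd as)))"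

text \<open>A suitable value always exists: a witness if there is one, and otherwise any element of
  the nonempty carrier.\<close>

lemma skolem_works:
  assumes "carrier \<AA> (fst x) \<noteq> {}"
  shows "fst (skolem \<AA> \<phi> x vs as) = fst x"
    and "snd (skolem \<AA> \<phi> x vs as) \<in> carrier \<AA> (fst x)"
    and "\<exists>b\<in>carrier \<AA> (fst x). sat \<AA> ((\<lambda>v. the (map_of (zip vs (map snd as)) v))(x := b)) \<phi> \<Longrightarrow>
      sat \<AA> ((\<lambda>v. the (map_of (zip vs (map snd as)) v))(x := snd (skolem \<AA> \<phi> x vs as))) \<phi>"
proof -
  let ?\<nu> = "\<lambda>v. the (map_of (zip vs (map snd as)) v)"
  let ?P = "\<lambda>a. a \<in> carrier \<AA> (fst x) \<and>
      ((\<exists>b\<in>carrier \<AA> (fst x). sat \<AA> (?\<nu>(x := b)) \<phi>) \<longrightarrow> sat \<AA> (?\<nu>(x := a)) \<phi>)"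
  have "\<exists>a. ?P a" using assms by blast
  then have "?P (SOME a. ?P a)" by (rule someI_ex)
  moreover have sk: "skolem \<AA> \<phi> x vs as = (fst x, SOME a. ?P a)"
    unfolding skolem_def Let_def ..
  ultimately have *: "?P (snd (skolem \<AA> \<phi> x vs as))"
    unfolding sk snd_conv by blast
  show "fst (skolem \<AA> \<phi> x vs as) = fst x" using sk by simp
  from * show "snd (skolem \<AA> \<phi> x vs as) \<in> carrier \<AA> (fst x)" by blast
  from * show "sat \<AA> (?\<nu>(x := snd (skolem \<AA> \<phi> x vs as))) \<phi>"
    if "\<exists>b\<in>carrier \<AA> (fst x). sat \<AA> (?\<nu>(x := b)) \<phi>"
    using that by blast
qed

lemma sorted_app_works:
  assumes "is_signature \<Sigma>" "is_structure \<Sigma> \<AA>" "f \<in> funs \<Sigma>"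
  shows "fst (sorted_app \<Sigma> \<AA> f as) = fun_cod \<Sigma> f"
    and "snd (sorted_app \<Sigma> \<AA> f as) \<in> carrier \<AA> (fun_cod \<Sigma> f)"
    and "map snd as \<in> tuples \<AA> (fun_dom \<Sigma> f) \<Longrightarrow>
      snd (sorted_app \<Sigma> \<AA> f as) = fun_int \<AA> f (map snd as)"
proof -
  let ?P = "\<lambda>a. a \<in> carrier \<AA> (fun_cod \<Sigma> f) \<and>
    (map snd as \<in> tuples \<AA> (fun_dom \<Sigma> f) \<longrightarrow> a = fun_int \<AA> f (map snd as))"
  have "carrier \<AA> (fun_cod \<Sigma> f) \<noteq> {}"
    "map snd as \<in> tuples \<AA> (fun_dom \<Sigma> f) \<Longrightarrow> fun_int \<AA> f (map snd as) \<in> carrier \<AA> (fun_cod \<Sigma> f)"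
    using assms by (auto simp: is_signature_def is_structure_def)
  then have "\<exists>a. ?P a" by blast
  then have "?P (SOME a. ?P a)" by (rule someI_ex)
  then show "fst (sorted_app \<Sigma> \<AA> f as) = fun_cod \<Sigma> f"
    "snd (sorted_app \<Sigma> \<AA> f as) \<in> carrier \<AA> (fun_cod \<Sigma> f)"
    "map snd as \<in> tuples \<AA> (fun_dom \<Sigma> f) \<Longrightarrow>
      snd (sorted_app \<Sigma> \<AA> f as) = fun_int \<AA> f (map snd as)"
    unfolding sorted_app_def by auto
qed

text \<open>The two structures differ only in their carriers, so only quantifiers need care. The
  condition \<open>wit\<close> speaks of truth in \<open>\<AA>\<close> alone and can be checked
  before anything is known about truth in the smaller structure.\<close>

lemma Tarski_Vaught:
  assumes sub: "\<And>\<sigma>. \<sigma> \<in> sorts \<Sigma> \<Longrightarrow> C \<sigma> \<subseteq> carrier \<AA> \<sigma>"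
    and wit: "\<And>\<phi> \<nu> x b. is_formula \<Sigma> \<phi> \<Longrightarrow> is_assignment \<Sigma> (\<AA>\<lparr>carrier := C\<rparr>) \<nu> \<Longrightarrow> fst x \<in> sorts \<Sigma> \<Longrightarrow>
      b \<in> carrier \<AA> (fst x) \<Longrightarrow> sat \<AA> (\<nu>(x := b)) \<phi> \<Longrightarrow> \<exists>a\<in>C (fst x). sat \<AA> (\<nu>(x := a)) \<phi>"
    and "is_formula \<Sigma> \<phi>" "is_assignment \<Sigma> (\<AA>\<lparr>carrier := C\<rparr>) \<nu>"
  shows "sat (\<AA>\<lparr>carrier := C\<rparr>) \<nu> \<phi> = sat \<AA> \<nu> \<phi>"
  using assms(3,4)
proof (induction \<phi> arbitrary: \<nu>)
  case (Atom p ts)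
  have "tm_val (\<AA>\<lparr>carrier := C\<rparr>) \<nu> = tm_val \<AA> \<nu>" by (rule ext) simp
  then show ?case by simp
next
  case (Forall x \<phi>)
  then have x: "fst x \<in> sorts \<Sigma>" and \<phi>: "is_formula \<Sigma> \<phi>" by simp_all
  have "is_assignment \<Sigma> (\<AA>\<lparr>carrier := C\<rparr>) (\<nu>(x := a))" if "a \<in> C (fst x)" for a
    using that Forall.prems(2) by (auto simp: is_assignment_def)
  then have "sat (\<AA>\<lparr>carrier := C\<rparr>) (\<nu>(x := a)) \<phi> = sat \<AA> (\<nu>(x := a)) \<phi>" if "a \<in> C (fst x)" for a
    using that Forall.IH \<phi> by blast
  \<comment> \<open>A counterexample \<open>b\<close> in \<open>\<AA>\<close> is a witness for
    \<open>Neg \<phi>\<close>, and \<open>wit\<close> moves it into \<open>C\<close>.\<close>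
  moreover have "sat \<AA> (\<nu>(x := b)) \<phi>"
    if "\<forall>a\<in>C (fst x). sat \<AA> (\<nu>(x := a)) \<phi>" "b \<in> carrier \<AA> (fst x)" for b
    using wit[of "Neg \<phi>" \<nu> x b] that x \<phi> Forall.prems(2) by auto
  ultimately show ?case using sub[OF x] by auto
next
  case (Exists x \<phi>)
  then have x: "fst x \<in> sorts \<Sigma>" and \<phi>: "is_formula \<Sigma> \<phi>" by simp_all
  have "is_assignment \<Sigma> (\<AA>\<lparr>carrier := C\<rparr>) (\<nu>(x := a))" if "a \<in> C (fst x)" for a
    using that Exists.prems(2) by (auto simp: is_assignment_def)
  then have "sat (\<AA>\<lparr>carrier := C\<rparr>) (\<nu>(x := a)) \<phi> = sat \<AA> (\<nu>(x := a)) \<phi>" if "a \<in> C (fst x)" for a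
    using that Exists.IH \<phi> by blast
  then show ?case using sub[OF x] wit[OF \<phi> Exists.prems(2) x] by auto
qed auto

text \<open>There are at most \<open>r\<close> triples of a formula, a variable and a finite list of
  parameter variables, hence at most \<open>r\<close> Skolem functions. Sizes are bounded from above
  only; lower bounds, and full carriers where they are wanted, are to be arranged through the choice
  of \<open>X\<close>.\<close>

lemma downward_Loewenheim_Skolem:
  fixes \<Sigma> :: "('s, 'f, 'p) msig" and \<AA> :: "('s, 'f, 'p, 'a) mstruct" and r :: "'k rel"
  assumes sig: "is_signature \<Sigma>" and str: "is_structure \<Sigma> \<AA>"
    and r: "Card_order r" "infinite (Field r)" and le: "sig_card \<Sigma> \<le>o r"
    and X: "\<And>\<sigma>. \<sigma> \<in> sorts \<Sigma> \<Longrightarrow> X \<sigma> \<subseteq> carrier \<AA> \<sigma>" "\<And>\<sigma>. \<sigma> \<in> sorts \<Sigma> \<Longrightarrow> |X \<sigma>| \<le>o r"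
  shows "\<exists>C. elementary_substructure \<Sigma> (\<AA>\<lparr>carrier := C\<rparr>) \<AA> \<and>
    (\<forall>\<sigma>\<in>sorts \<Sigma>. X \<sigma> \<subseteq> C \<sigma> \<and> |C \<sigma>| \<le>o r)"
proof -
  note ordLeq_intros = closure_ordLeq[OF r] Un_ordLeq[OF r] image_ordLeq[OF r] Times_ordLeq[OF r]
    lists_ordLeq[OF r] formulas_ordLeq[OF r] nat_set_ordLeq[OF r]
  have le': "|sorts \<Sigma>| \<le>o r" "|funs \<Sigma>| \<le>o r" "|preds \<Sigma>| \<le>o r"
    using le unfolding sig_card_def
    by (meson ordLeq_transitive ordLeq_csum1 ordLeq_csum2 card_of_Card_order Card_order_csum)+
  let ?V = "sorts \<Sigma> \<times> (UNIV :: nat set)"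
  let ?G = "(\<lambda>(\<phi>, x, vs). skolem \<AA> \<phi> x vs) ` ({\<phi>. is_formula \<Sigma> \<phi>} \<times> ?V \<times> lists ?V) \<union>
    sorted_app \<Sigma> \<AA> ` funs \<Sigma>"
  \<comment> \<open>Closure under the functions of the signature follows from the Tarski-Vaught property, but
    closing under them explicitly avoids choosing fresh variables.\<close>
  define H where "H = closure ?G (Sigma (sorts \<Sigma>) X)"
  define C where "C \<sigma> = {a. (\<sigma>, a) \<in> H}" for \<sigma>
  have ne: "carrier \<AA> \<sigma> \<noteq> {}" if "\<sigma> \<in> sorts \<Sigma>" for \<sigma>
    using that str by (auto simp: is_structure_def)
  have "|Sigma (sorts \<Sigma>) X| \<le>o r"
    using X(2) le'(1) by (intro card_of_Sigma_ordLeq_infinite_Field r) auto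
  then have cardH: "|H| \<le>o r"
    unfolding H_def by (intro ordLeq_intros le')
  have "H \<subseteq> Sigma (sorts \<Sigma>) (carrier \<AA>)"
    unfolding H_def
  proof (rule closure_subset)
    show "Sigma (sorts \<Sigma>) X \<subseteq> Sigma (sorts \<Sigma>) (carrier \<AA>)" using X(1) by auto
  next
    fix g xs assume "g \<in> ?G"
    then consider \<phi> x vs where "fst x \<in> sorts \<Sigma>" "g = skolem \<AA> \<phi> x vs"
      | f where "f \<in> funs \<Sigma>" "g = sorted_app \<Sigma> \<AA> f" by auto
    then show "g xs \<in> Sigma (sorts \<Sigma>) (carrier \<AA>)"
    proof cases
      case 1
      then show ?thesis
        using skolem_works(1,2)[OF ne[OF 1(1)], of \<phi> vs xs] by (cases "g xs") auto
    next
      case 2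
      then have "fun_cod \<Sigma> f \<in> sorts \<Sigma>" using sig by (auto simp: is_signature_def)
      with 2 show ?thesis
        using sorted_app_works(1,2)[OF sig str 2(1), of xs] by (cases "g xs") auto
    qed
  qed
  then have sub: "C \<sigma> \<subseteq> carrier \<AA> \<sigma>" for \<sigma> by (auto simp: C_def)
  have wit: "\<exists>a\<in>C (fst x). sat \<AA> (\<nu>(x := a)) \<phi>"
    if \<phi>: "is_formula \<Sigma> \<phi>" and \<nu>: "is_assignment \<Sigma> (\<AA>\<lparr>carrier := C\<rparr>) \<nu>" and x: "fst x \<in> sorts \<Sigma>"
      and b: "b \<in> carrier \<AA> (fst x)" "sat \<AA> (\<nu>(x := b)) \<phi>" for \<phi> \<nu> x b
  proof -
    obtain V where V: "finite V" "V \<subseteq> ?V"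
      "\<And>\<mu> \<nu>. \<forall>x\<in>V. \<mu> x = \<nu> x \<Longrightarrow> sat \<AA> \<mu> \<phi> = sat \<AA> \<nu> \<phi>"
      using sat_finite_support[OF \<phi>] by metis
    obtain vs where vs: "set vs = V" using \<open>finite V\<close> finite_list by blast
    \<comment> \<open>Tagging each value with the sort of its variable makes \<open>as\<close> a
      list over \<open>H\<close>, since \<open>\<nu>\<close> takes values in
      \<open>C\<close>.\<close>
    define as where "as = map (\<lambda>v. (fst v, \<nu> v)) vs"
    have in_sorts: "fst v \<in> sorts \<Sigma>" if "v \<in> set vs" for v
      using that vs V(2) by auto
    have "as \<in> lists H"
      using in_sorts \<nu> by (fastforce simp: as_def is_assignment_def C_def)
    moreover have "skolem \<AA> \<phi> x vs \<in> ?G"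
      using \<phi> x vs V(2)
      by (intro UnI1 image_eqI[of _ _ "(\<phi>, x, vs)"]) (auto simp: mem_Times_iff)
    ultimately have "skolem \<AA> \<phi> x vs as \<in> H"
      unfolding H_def by (rule closure.step[rotated])
    then have inC: "snd (skolem \<AA> \<phi> x vs as) \<in> C (fst x)"
      using skolem_works(1)[OF ne[OF x]] by (metis C_def mem_Collect_eq prod.collapse)
    \<comment> \<open>Off \<open>vs\<close> this assignment has the unspecified value
      \<open>the None\<close>; agreement with \<open>\<nu>\<close> on the support \<open>V\<close>
      is enough.\<close>
    let ?\<mu> = "\<lambda>v. the (map_of (zip vs (map snd as)) v)"
    have "map_of (zip vs (map snd as)) v = Some (\<nu> v)" if "v \<in> V" for v
      using that vs by (simp add: as_def comp_def map_of_zip_map)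
    then have eq: "sat \<AA> (?\<mu>(x := a)) \<phi> = sat \<AA> (\<nu>(x := a)) \<phi>" for a
      by (intro V(3)) auto
    show ?thesis
      using skolem_works(3)[OF ne[OF x], of vs as \<phi>] b inC unfolding eq by blast
  qed
  have XC: "X \<sigma> \<subseteq> C \<sigma>" if "\<sigma> \<in> sorts \<Sigma>" for \<sigma>
    using that by (auto simp: C_def H_def intro: closure.base)
  \<comment> \<open>\<open>X \<sigma>\<close> may be empty. A Skolem function applied to the empty
    list still yields an element of sort \<open>\<sigma>\<close>, and the equality symbol of
    \<open>\<sigma>\<close> guarantees a formula to take it from.\<close>
  have neC: "C \<sigma> \<noteq> {}" if "\<sigma> \<in> sorts \<Sigma>" for \<sigma>
  proof -
    let ?E = "Atom (eq_sym \<Sigma> \<sigma>) [Var (\<sigma>, 0), Var (\<sigma>, 0)]"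
    have "is_formula \<Sigma> ?E"
      using that sig by (auto simp: is_signature_def intro: is_term.intros)
    then have G: "skolem \<AA> ?E (\<sigma>, 0) [] \<in> ?G"
      using that by (intro UnI1 image_eqI[of _ _ "(?E, (\<sigma>, 0), [])"]) simp_all
    have "skolem \<AA> ?E (\<sigma>, 0) [] [] \<in> H"
      unfolding H_def by (rule closure.step[OF G]) simp
    then show ?thesis using skolem_works(1)[of \<AA> "(\<sigma>, 0)"] ne[OF that]
      by (metis C_def mem_Collect_eq prod.collapse empty_iff fst_conv)
  qed
  have clos: "fun_int \<AA> f as \<in> C (fun_cod \<Sigma> f)"
    if f: "f \<in> funs \<Sigma>" and as: "as \<in> tuples (\<AA>\<lparr>carrier := C\<rparr>) (fun_dom \<Sigma> f)" for f as
  proof -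
    have all: "list_all2 (\<lambda>a \<sigma>. a \<in> C \<sigma>) as (fun_dom \<Sigma> f)" using as by (simp add: tuples_def)
    \<comment> \<open>The arguments are tagged with the sorts that \<open>f\<close> expects, which
      turns them into elements of \<open>H\<close>.\<close>
    let ?bs = "zip (fun_dom \<Sigma> f) as"
    have len: "length as = length (fun_dom \<Sigma> f)" using all by (rule list_all2_lengthD)
    have "?bs \<in> lists H"
      using all by (auto simp: list_all2_conv_all_nth set_zip C_def)
    then have "sorted_app \<Sigma> \<AA> f ?bs \<in> H"
      unfolding H_def using f by (intro closure.step) auto
    moreover have "as \<in> tuples \<AA> (fun_dom \<Sigma> f)"
      using all sub unfolding tuples_def by (auto elim!: list_all2_mono)
    ultimately show ?thesis
      using sorted_app_works(1,3)[OF sig str f, of ?bs] len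
      by (metis C_def mem_Collect_eq prod.collapse map_snd_zip)
  qed
  have strC: "is_structure \<Sigma> (\<AA>\<lparr>carrier := C\<rparr>)"
    using str neC clos sub unfolding is_structure_def by (auto simp: subset_iff)
  have "substructure \<Sigma> (\<AA>\<lparr>carrier := C\<rparr>) \<AA>"
    using strC str sub unfolding substructure_def by simp
  then have "elementary_substructure \<Sigma> (\<AA>\<lparr>carrier := C\<rparr>) \<AA>"
    using Tarski_Vaught[OF sub, of \<Sigma>] wit unfolding elementary_substructure_def by blast
  moreover have "|C \<sigma>| \<le>o r" for \<sigma>
  proof -
    have "C \<sigma> \<subseteq> snd ` H" by (force simp: C_def)
    then show ?thesis by (rule subset_ordLeq) (rule image_ordLeq[OF r cardH])
  qed
  ultimately show ?thesis using XC by blast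
qed

section \<open>Formulas over a split signature\<close>

text \<open>The result sort decides the part: the part that owns the head symbol contains its result
  sort, so by disjointness it is \<open>l\<close>. It also contains the argument sorts, so the
  induction passes to the arguments.\<close>

lemma split_into_is_term:
  assumes "split_into \<Sigma> \<Lambda> \<Sigma>s" "l \<in> \<Lambda>" "is_term \<Sigma> t \<sigma>" "\<sigma> \<in> l"
  shows "is_term (\<Sigma>s l) t \<sigma>"
  using assms(3,4)
proof induction
  case (1 \<sigma> n)
  then show ?case using assms by (auto simp: split_into_def intro: is_term.intros)
next
  case (2 f ts)
  then obtain l' where l': "l' \<in> \<Lambda>" "f \<in> funs (\<Sigma>s l')"
    using assms(1) by (auto simp: split_into_def)
  then have f: "fun_dom (\<Sigma>s l') f = fun_dom \<Sigma> f" "fun_cod (\<Sigma>s l') f = fun_cod \<Sigma> f"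
    "set (fun_dom \<Sigma> f) \<subseteq> l'" "fun_cod \<Sigma> f \<in> l'"
    using assms(1) by (fastforce simp: split_into_def subsignature_def is_signature_def)+
  have "l' = l"
    using f(4) 2(3) l'(1) assms(1,2) by (auto simp: split_into_def partition_on_def disjoint_def)
  moreover from this have "list_all2 (is_term (\<Sigma>s l)) ts (fun_dom \<Sigma> f)"
    using 2(2) f(3) by (auto simp: list_all2_conv_all_nth subset_iff)
  ultimately show ?case using is_term.intros(2)[of f "\<Sigma>s l" ts] l' f by simp
qed

text \<open>The formula is the conjunction of the members of \<open>\<Phi>\<close> that lie in
  \<open>S\<close> and the negations of the others.\<close>

lemma complete_description:
  fixes \<Sigma> :: "('s, 'f, 'p) msig"
  assumes "is_signature \<Sigma>" "finite \<Phi>" "\<And>\<phi>. \<phi> \<in> \<Phi> \<Longrightarrow> is_formula \<Sigma> \<phi>"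
  shows "\<exists>\<chi>. is_formula \<Sigma> \<chi> \<and>
    (\<forall>(M :: ('s, 'f, 'p, 'a) mstruct) \<nu>. sat M \<nu> \<chi> \<longleftrightarrow> (\<forall>\<phi>\<in>\<Phi>. sat M \<nu> \<phi> \<longleftrightarrow> \<phi> \<in> S))"
  using assms(2,3)
proof (induction \<Phi>)
  case empty
  obtain \<sigma> where \<sigma>: "\<sigma> \<in> sorts \<Sigma>" using assms(1) by (auto simp: is_signature_def)
  let ?E = "Atom (eq_sym \<Sigma> \<sigma>) [Var (\<sigma>, 0), Var (\<sigma>, 0)]"
  \<comment> \<open>The empty conjunction must hold in every \<open>M\<close>, which need not
    interpret the equality symbol as equality; hence an implication in place of the bare
    atom.\<close>
  have "is_formula \<Sigma> (Imp ?E ?E)"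
    using \<sigma> assms(1) by (auto simp: is_signature_def intro: is_term.intros)
  then show ?case by (intro exI[of _ "Imp ?E ?E"]) simp
next
  case (insert \<phi> \<Phi>)
  then obtain \<chi> where \<chi>: "is_formula \<Sigma> \<chi>"
    "\<And>(M :: ('s, 'f, 'p, 'a) mstruct) \<nu>. sat M \<nu> \<chi> \<longleftrightarrow> (\<forall>\<phi>\<in>\<Phi>. sat M \<nu> \<phi> \<longleftrightarrow> \<phi> \<in> S)" by auto
  let ?\<chi> = "Conj (if \<phi> \<in> S then \<phi> else Neg \<phi>) \<chi>"
  have "is_formula \<Sigma> ?\<chi>" using \<chi>(1) insert.prems by simp
  moreover have "sat M \<nu> ?\<chi> \<longleftrightarrow> (\<forall>\<phi>\<in>insert \<phi> \<Phi>. sat M \<nu> \<phi> \<longleftrightarrow> \<phi> \<in> S)"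
    for M :: "('s, 'f, 'p, 'a) mstruct" and \<nu>
    by (simp add: \<chi>(2))
  ultimately show ?case by blast
qed

text \<open>
  Determination by finitely many formulas, rather than equivalence to a Boolean combination of
  them, avoids disjunctive normal forms in the induction: for \<open>\<exists>x\<close> with \<open>x\<close> of a sort in \<open>l\<close>, the
  formulas over \<open>\<Sigma>s l\<close> are replaced by those saying that some \<open>x\<close> realises a given truth pattern
  of them, and the other formulas do not depend on \<open>x\<close>.
\<close>

lemma split_into_finitely_determined:
  fixes \<Sigma> :: "('s, 'f, 'p) msig"
  assumes split: "split_into \<Sigma> \<Lambda> \<Sigma>s" and "is_formula \<Sigma> \<phi>"
  shows "\<exists>\<Phi>. finite \<Phi> \<and> (\<forall>\<psi>\<in>\<Phi>. \<exists>l\<in>\<Lambda>. is_formula (\<Sigma>s l) \<psi>) \<and>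
    (\<forall>(M :: ('s, 'f, 'p, 'a) mstruct) (N :: ('s, 'f, 'p, 'a) mstruct) \<mu> \<nu>.
      (\<forall>\<psi>\<in>\<Phi>. sat M \<mu> \<psi> = sat N \<nu> \<psi>) \<longrightarrow> sat M \<mu> \<phi> = sat N \<nu> \<phi>)"
proof -
  define P where "P \<phi> \<Phi> \<longleftrightarrow> finite \<Phi> \<and> (\<forall>\<psi>\<in>\<Phi>. \<exists>l\<in>\<Lambda>. is_formula (\<Sigma>s l) \<psi>) \<and>
    (\<forall>(M :: ('s, 'f, 'p, 'a) mstruct) (N :: ('s, 'f, 'p, 'a) mstruct) \<mu> \<nu>.
      (\<forall>\<psi>\<in>\<Phi>. sat M \<mu> \<psi> = sat N \<nu> \<psi>) \<longrightarrow> sat M \<mu> \<phi> = sat N \<nu> \<phi>)" for \<phi> \<Phi>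
  have disj: "disjoint \<Lambda>" and cover: "\<Union>\<Lambda> = sorts \<Sigma>"
    and sorts: "\<And>l. l \<in> \<Lambda> \<Longrightarrow> sorts (\<Sigma>s l) = l"
    using split by (simp_all add: split_into_def partition_on_def)
  have neg: "\<exists>\<Phi>. P (Neg \<phi>) \<Phi>" if "\<exists>\<Phi>. P \<phi> \<Phi>" for \<phi> using that by (simp add: P_def)
  have ex: "\<exists>\<Phi>. P (Exists x \<phi>) \<Phi>" if P: "\<exists>\<Phi>. P \<phi> \<Phi>" and x: "fst x \<in> sorts \<Sigma>" for x \<phi>
  proof -
    obtain \<Phi> where \<Phi>: "finite \<Phi>" "\<And>\<psi>. \<psi> \<in> \<Phi> \<Longrightarrow> \<exists>l\<in>\<Lambda>. is_formula (\<Sigma>s l) \<psi>"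
      "\<And>(M :: ('s, 'f, 'p, 'a) mstruct) (N :: ('s, 'f, 'p, 'a) mstruct) \<mu> \<nu>.
        (\<forall>\<psi>\<in>\<Phi>. sat M \<mu> \<psi> = sat N \<nu> \<psi>) \<Longrightarrow> sat M \<mu> \<phi> = sat N \<nu> \<phi>"
      using P unfolding P_def by blast
    obtain l where l: "l \<in> \<Lambda>" "fst x \<in> l" using x cover by blast
    have sigl: "is_signature (\<Sigma>s l)" using split l by (simp add: split_into_def)
    define \<Phi>\<^sub>l where "\<Phi>\<^sub>l = {\<psi> \<in> \<Phi>. is_formula (\<Sigma>s l) \<psi>}"
    have "\<exists>\<chi>. is_formula (\<Sigma>s l) \<chi> \<and>
      (\<forall>(M :: ('s, 'f, 'p, 'a) mstruct) \<nu>. sat M \<nu> \<chi> \<longleftrightarrow> (\<forall>\<phi>\<in>\<Phi>\<^sub>l. sat M \<nu> \<phi> \<longleftrightarrow> \<phi> \<in> S))" for S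
      using \<Phi>(1) by (intro complete_description sigl) (auto simp: \<Phi>\<^sub>l_def)
    then obtain \<chi> where \<chi>: "\<And>S. is_formula (\<Sigma>s l) (\<chi> S)"
      "\<And>S (M :: ('s, 'f, 'p, 'a) mstruct) \<nu>. sat M \<nu> (\<chi> S) \<longleftrightarrow> (\<forall>\<phi>\<in>\<Phi>\<^sub>l. sat M \<nu> \<phi> \<longleftrightarrow> \<phi> \<in> S)"
      by metis
    let ?\<Psi> = "(\<Phi> - \<Phi>\<^sub>l) \<union> (\<lambda>S. Exists x (\<chi> S)) ` Pow \<Phi>\<^sub>l"
    \<comment> \<open>A formula in \<open>\<Phi>\<close> that is not over \<open>\<Sigma>s l\<close>
      comes from another part, and by disjointness that part lacks the sort of
      \<open>x\<close>.\<close>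
    have upd: "sat M (\<nu>(x := a)) \<psi> = sat M \<nu> \<psi>" if "\<psi> \<in> \<Phi> - \<Phi>\<^sub>l"
      for M :: "('s, 'f, 'p, 'a) mstruct" and \<nu> a \<psi>
    proof -
      obtain l' where l': "l' \<in> \<Lambda>" "is_formula (\<Sigma>s l') \<psi>" using \<Phi>(2) \<open>\<psi> \<in> \<Phi> - \<Phi>\<^sub>l\<close> by blast
      then have "l' \<noteq> l" using that by (auto simp: \<Phi>\<^sub>l_def)
      then have "fst x \<notin> sorts (\<Sigma>s l')"
        using l l'(1) disj sorts[OF l'(1)] by (auto simp: disjoint_def)
      then show ?thesis by (rule sat_upd_other_sort[OF l'(2)])
    qed
    have transfer: "sat N \<nu> (Exists x \<phi>)"
      if agree: "\<forall>\<psi>\<in>?\<Psi>. sat M \<mu> \<psi> = sat N \<nu> \<psi>" and sat: "sat M \<mu> (Exists x \<phi>)"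
      for M N :: "('s, 'f, 'p, 'a) mstruct" and \<mu> \<nu>
    proof -
      obtain a where a: "a \<in> carrier M (fst x)" "sat M (\<mu>(x := a)) \<phi>" using sat by auto
      \<comment> \<open>\<open>S\<close> is the truth pattern of \<open>\<Phi>\<^sub>l\<close> at
        the witness \<open>a\<close>. That some element realises it is expressed in
        \<open>?\<Psi>\<close>, so \<open>N\<close> has such an element \<open>b\<close> as
        well.\<close>
      define S where "S = {\<psi> \<in> \<Phi>\<^sub>l. sat M (\<mu>(x := a)) \<psi>}"
      have "sat M (\<mu>(x := a)) (\<chi> S)" by (auto simp: \<chi>(2) S_def)
      then have "sat M \<mu> (Exists x (\<chi> S))" using a(1) by auto
      moreover have "Exists x (\<chi> S) \<in> ?\<Psi>" by (auto simp: S_def)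
      ultimately have "sat N \<nu> (Exists x (\<chi> S))" using agree by blast
      then obtain b where b: "b \<in> carrier N (fst x)" "sat N (\<nu>(x := b)) (\<chi> S)" by auto
      have "sat M (\<mu>(x := a)) \<psi> = sat N (\<nu>(x := b)) \<psi>" if "\<psi> \<in> \<Phi>" for \<psi>
      proof (cases "\<psi> \<in> \<Phi>\<^sub>l")
        case True
        then show ?thesis using b(2) by (simp add: \<chi>(2) S_def)
      next
        case False
        then have "sat M \<mu> \<psi> = sat N \<nu> \<psi>" using that agree by blast
        then show ?thesis using that False by (simp add: upd)
      qed
      then have "sat N (\<nu>(x := b)) \<phi>" using \<Phi>(3) a(2) by blast
      then show ?thesis using b(1) by auto
    qed
    have "finite ?\<Psi>" using \<Phi>(1) by (simp add: \<Phi>\<^sub>l_def)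
    moreover have "\<exists>l\<in>\<Lambda>. is_formula (\<Sigma>s l) \<psi>" if \<psi>: "\<psi> \<in> ?\<Psi>" for \<psi>
    proof (cases "\<psi> \<in> \<Phi>")
      case True
      then show ?thesis by (rule \<Phi>(2))
    next
      case False
      then obtain S where "\<psi> = Exists x (\<chi> S)" using \<psi> by blast
      then have "is_formula (\<Sigma>s l) \<psi>" using \<chi>(1) l(2) sorts[OF l(1)] by simp
      then show ?thesis using l(1) by blast
    qed
    moreover have "sat M \<mu> (Exists x \<phi>) = sat N \<nu> (Exists x \<phi>)"
      if "\<forall>\<psi>\<in>?\<Psi>. sat M \<mu> \<psi> = sat N \<nu> \<psi>" for M N :: "('s, 'f, 'p, 'a) mstruct" and \<mu> \<nu>
    proof
      assume "sat M \<mu> (Exists x \<phi>)"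
      with that show "sat N \<nu> (Exists x \<phi>)" by (rule transfer)
    next
      have "\<forall>\<psi>\<in>?\<Psi>. sat N \<nu> \<psi> = sat M \<mu> \<psi>"
        by (intro ballI that[THEN bspec, THEN sym])
      moreover assume "sat N \<nu> (Exists x \<phi>)"
      ultimately show "sat M \<mu> (Exists x \<phi>)" by (rule transfer)
    qed
    ultimately have "P (Exists x \<phi>) ?\<Psi>" unfolding P_def by (intro conjI ballI allI impI)
    then show ?thesis ..
  qed
  have join: "P \<chi> (\<Phi> \<union> \<Psi>)"
    if "P \<phi> \<Phi>" "P \<psi> \<Psi>" and \<chi>: "\<And>(M :: ('s, 'f, 'p, 'a) mstruct) (N :: ('s, 'f, 'p, 'a) mstruct) \<mu> \<nu>.
      sat M \<mu> \<phi> = sat N \<nu> \<phi> \<Longrightarrow> sat M \<mu> \<psi> = sat N \<nu> \<psi> \<Longrightarrow> sat M \<mu> \<chi> = sat N \<nu> \<chi>"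
    for \<phi> \<psi> \<chi> \<Phi> \<Psi>
    unfolding P_def
  proof (intro conjI allI impI)
    fix M N :: "('s, 'f, 'p, 'a) mstruct" and \<mu> \<nu> :: "'s var \<Rightarrow> 'a"
    assume "\<forall>\<theta>\<in>\<Phi> \<union> \<Psi>. sat M \<mu> \<theta> = sat N \<nu> \<theta>"
    then show "sat M \<mu> \<chi> = sat N \<nu> \<chi>"
      using that(1,2) by (intro \<chi>) (simp_all add: P_def ball_Un)
  qed (use that in \<open>auto simp: P_def\<close>)
  have "\<exists>\<Phi>. P \<phi> \<Phi>"
    using assms(2)
  proof (induction \<phi>)
    case (Atom p ts)
    \<comment> \<open>A nullary \<open>p\<close> may belong to several parts; any of them will
      do.\<close>
    then obtain l where l: "l \<in> \<Lambda>" "p \<in> preds (\<Sigma>s l)" using split by (auto simp: split_into_def)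
    then have p: "pred_dom (\<Sigma>s l) p = pred_dom \<Sigma> p" "set (pred_dom \<Sigma> p) \<subseteq> l"
      using split by (fastforce simp: split_into_def subsignature_def is_signature_def)+
    have "list_all2 (is_term (\<Sigma>s l)) ts (pred_dom \<Sigma> p)"
      using Atom p(2) split_into_is_term[OF split l(1)]
      by (auto simp: list_all2_conv_all_nth subset_iff)
    then have "is_formula (\<Sigma>s l) (Atom p ts)" using l(2) p(1) by simp
    then have "P (Atom p ts) {Atom p ts}" using l(1) by (auto simp: P_def)
    then show ?case ..
  next
    case (Neg \<phi>)
    then show ?case using neg by simp
  next
    case (Conj \<phi> \<psi>)
    then obtain \<Phi> \<Psi> where "P \<phi> \<Phi>" "P \<psi> \<Psi>" by auto
    then have "P (Conj \<phi> \<psi>) (\<Phi> \<union> \<Psi>)" by (rule join) simp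
    then show ?case ..
  next
    case (Disj \<phi> \<psi>)
    then obtain \<Phi> \<Psi> where "P \<phi> \<Phi>" "P \<psi> \<Psi>" by auto
    then have "P (Disj \<phi> \<psi>) (\<Phi> \<union> \<Psi>)" by (rule join) simp
    then show ?case ..
  next
    case (Imp \<phi> \<psi>)
    then obtain \<Phi> \<Psi> where "P \<phi> \<Phi>" "P \<psi> \<Psi>" by auto
    then have "P (Imp \<phi> \<psi>) (\<Phi> \<union> \<Psi>)" by (rule join) simp
    then show ?case ..
  next
    case (Forall x \<phi>)
    \<comment> \<open>\<open>P\<close> depends only on the truth conditions of its formula, so the
      dual form can stand in for \<open>Forall\<close>.\<close>
    then have "\<exists>\<Phi>. P (Neg (Exists x (Neg \<phi>))) \<Phi>" using neg ex by simp
    then show ?case by (simp add: P_def)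
  next
    case (Exists x \<phi>)
    then show ?case using ex by simp
  qed
  then show ?thesis unfolding P_def .
qed

section \<open>Gluing the hulls of the parts\<close>

theorem theorem8:
  fixes \<Sigma> :: "('s, 'f, 'p) msig"
    and \<Lambda> :: "'s set set"
    and \<Sigma>s :: "'s set \<Rightarrow> ('s, 'f, 'p) msig"
    and \<AA> :: "('s, 'f, 'p, 'a) mstruct"
    and \<kappa> :: "'s set \<Rightarrow> 'k rel"
    and A :: "'s \<Rightarrow> 'a set"
  assumes "is_signature \<Sigma>"
    and "split_into \<Sigma> \<Lambda> \<Sigma>s"
    and "is_structure \<Sigma> \<AA>"
    and "\<And>l. l \<in> \<Lambda> \<Longrightarrow> Card_order (\<kappa> l)"
    and "\<And>l. l \<in> \<Lambda> \<Longrightarrow> natLeq \<le>o \<kappa> l"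
    and "\<And>l. l \<in> \<Lambda> \<Longrightarrow> sig_card (\<Sigma>s l) \<le>o \<kappa> l"
    and "\<And>l \<sigma>. l \<in> \<Lambda> \<Longrightarrow> \<sigma> \<in> inf_sorts \<Sigma> \<AA> \<inter> l \<Longrightarrow> \<kappa> l \<le>o |carrier \<AA> \<sigma>|"
    and "\<And>l \<sigma>. l \<in> \<Lambda> \<Longrightarrow> \<sigma> \<in> inf_sorts \<Sigma> \<AA> \<inter> l \<Longrightarrow> A \<sigma> \<subseteq> carrier \<AA> \<sigma>"
    and "\<And>l \<sigma>. l \<in> \<Lambda> \<Longrightarrow> \<sigma> \<in> inf_sorts \<Sigma> \<AA> \<inter> l \<Longrightarrow> |A \<sigma>| \<le>o \<kappa> l"
  shows "\<exists>\<BB>. elementary_substructure \<Sigma> \<BB> \<AA> \<and>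
    (\<forall>l\<in>\<Lambda>. \<forall>\<sigma>\<in>inf_sorts \<Sigma> \<AA> \<inter> l. |carrier \<BB> \<sigma>| =o \<kappa> l \<and> A \<sigma> \<subseteq> carrier \<BB> \<sigma>) \<and>
    (\<forall>\<sigma>\<in>fin_sorts \<Sigma> \<AA>. carrier \<BB> \<sigma> = carrier \<AA> \<sigma>)"
proof -
  note split = assms(2) and str = assms(3)
  have part: "partition_on (sorts \<Sigma>) \<Lambda>"
    and sigl: "\<And>l. l \<in> \<Lambda> \<Longrightarrow> is_signature (\<Sigma>s l)"
    and sorts: "\<And>l. l \<in> \<Lambda> \<Longrightarrow> sorts (\<Sigma>s l) = l"
    and subsig: "\<And>l. l \<in> \<Lambda> \<Longrightarrow> subsignature (\<Sigma>s l) \<Sigma>"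
    and funs: "funs \<Sigma> = (\<Union>l\<in>\<Lambda>. funs (\<Sigma>s l))"
    using split by (simp_all add: split_into_def)
  have cover: "\<Union>\<Lambda> = sorts \<Sigma>"
    using part by (simp add: partition_on_def)
  have block: "l \<subseteq> sorts \<Sigma>" if "l \<in> \<Lambda>" for l
    using part that by (auto simp: partition_on_def)
  have strl: "is_structure (\<Sigma>s l) \<AA>" if "l \<in> \<Lambda>" for l
    using str subsig[OF that] by (auto simp: is_structure_def subsignature_def subset_iff)
  \<comment> \<open>The starting sets settle the sizes in advance: on an infinite sort
    \<open>X\<close> has size \<open>\<kappa> l\<close> and contains \<open>A \<sigma>\<close>, on a
    finite sort it is the whole carrier. The hull contains \<open>X\<close> and stays of size at
    most \<open>\<kappa> l\<close>.\<close>
  have "\<exists>X. (\<forall>\<sigma>\<in>l. X \<sigma> \<subseteq> carrier \<AA> \<sigma> \<and> |X \<sigma>| \<le>o \<kappa> l) \<and>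
      (\<forall>\<sigma>\<in>inf_sorts \<Sigma> \<AA> \<inter> l. \<kappa> l \<le>o |X \<sigma>| \<and> A \<sigma> \<subseteq> X \<sigma>) \<and>
      (\<forall>\<sigma>\<in>fin_sorts \<Sigma> \<AA> \<inter> l. X \<sigma> = carrier \<AA> \<sigma>)"
    if l: "l \<in> \<Lambda>" for l
  proof -
    have r: "Card_order (\<kappa> l)" "infinite (Field (\<kappa> l))"
      using assms(4,5)[OF l] infinite_Field by auto
    have "\<exists>Y. Y \<subseteq> carrier \<AA> \<sigma> \<and> |Y| \<le>o \<kappa> l \<and>
        (\<sigma> \<in> inf_sorts \<Sigma> \<AA> \<longrightarrow> \<kappa> l \<le>o |Y| \<and> A \<sigma> \<subseteq> Y) \<and>
        (\<sigma> \<in> fin_sorts \<Sigma> \<AA> \<longrightarrow> Y = carrier \<AA> \<sigma>)" if \<sigma>: "\<sigma> \<in> l" for \<sigma>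
    proof (cases "\<sigma> \<in> inf_sorts \<Sigma> \<AA>")
      case True
      with \<sigma> have \<sigma>': "\<sigma> \<in> inf_sorts \<Sigma> \<AA> \<inter> l" by simp
      have "|Field (\<kappa> l)| \<le>o |carrier \<AA> \<sigma>|"
        using assms(7)[OF l \<sigma>'] card_of_Field_ordIso[OF r(1)] ordIso_ordLeq_trans by blast
      \<comment> \<open>\<open>A \<sigma>\<close> may be smaller than \<open>\<kappa> l\<close>, so
        it is padded with a subset \<open>Y\<close> of the carrier of size exactly
        \<open>\<kappa> l\<close>.\<close>
      then obtain Y where Y: "Y \<subseteq> carrier \<AA> \<sigma>" "|Field (\<kappa> l)| =o |Y|"
        unfolding internalize_card_of_ordLeq2[of "Field (\<kappa> l)"] by blast
      have Yr: "\<kappa> l =o |Y|"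
        using Y(2) card_of_Field_ordIso[OF r(1)] ordIso_symmetric ordIso_transitive by blast
      then have "|A \<sigma> \<union> Y| \<le>o \<kappa> l"
        by (intro Un_ordLeq[OF r] assms(9)[OF l \<sigma>']) (simp add: ordIso_iff_ordLeq)
      moreover have "\<kappa> l \<le>o |A \<sigma> \<union> Y|"
        using Yr card_of_mono1[of Y "A \<sigma> \<union> Y"] ordIso_ordLeq_trans by blast
      ultimately show ?thesis
        using Y(1) assms(8)[OF l \<sigma>'] True by (intro exI[of _ "A \<sigma> \<union> Y"]) (auto simp: fin_sorts_def)
    next
      case False
      then have "finite (carrier \<AA> \<sigma>)"
        using block[OF l] \<sigma> infinite_iff_natLeq_ordLeq by (auto simp: inf_sorts_def)
      then show ?thesis
        using False finite_set_ordLeq[OF r] by (intro exI[of _ "carrier \<AA> \<sigma>"]) simp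
    qed
    then obtain X where "\<forall>\<sigma>\<in>l. X \<sigma> \<subseteq> carrier \<AA> \<sigma> \<and> |X \<sigma>| \<le>o \<kappa> l \<and>
        (\<sigma> \<in> inf_sorts \<Sigma> \<AA> \<longrightarrow> \<kappa> l \<le>o |X \<sigma>| \<and> A \<sigma> \<subseteq> X \<sigma>) \<and>
        (\<sigma> \<in> fin_sorts \<Sigma> \<AA> \<longrightarrow> X \<sigma> = carrier \<AA> \<sigma>)" by metis
    then show ?thesis by (intro exI[of _ X]) blast
  qed
  then obtain X where
    X: "\<And>l \<sigma>. l \<in> \<Lambda> \<Longrightarrow> \<sigma> \<in> l \<Longrightarrow> X l \<sigma> \<subseteq> carrier \<AA> \<sigma> \<and> |X l \<sigma>| \<le>o \<kappa> l"
    and Xinf: "\<And>l \<sigma>. l \<in> \<Lambda> \<Longrightarrow> \<sigma> \<in> inf_sorts \<Sigma> \<AA> \<inter> l \<Longrightarrow> \<kappa> l \<le>o |X l \<sigma>| \<and> A \<sigma> \<subseteq> X l \<sigma>"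
    and Xfin: "\<And>l \<sigma>. l \<in> \<Lambda> \<Longrightarrow> \<sigma> \<in> fin_sorts \<Sigma> \<AA> \<inter> l \<Longrightarrow> X l \<sigma> = carrier \<AA> \<sigma>"
    by metis
  have "\<exists>C. elementary_substructure (\<Sigma>s l) (\<AA>\<lparr>carrier := C\<rparr>) \<AA> \<and>
      (\<forall>\<sigma>\<in>l. X l \<sigma> \<subseteq> C \<sigma> \<and> |C \<sigma>| \<le>o \<kappa> l)" if l: "l \<in> \<Lambda>" for l
  proof -
    have "infinite (Field (\<kappa> l))"
      using assms(4,5)[OF l] infinite_Field by auto
    then show ?thesis
      using downward_Loewenheim_Skolem[OF sigl strl assms(4) _ assms(6), OF l l l _ l, of "X l"]
        X[OF l] sorts[OF l] by auto
  qed
  then obtain C where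
    C: "\<And>l. l \<in> \<Lambda> \<Longrightarrow> elementary_substructure (\<Sigma>s l) (\<AA>\<lparr>carrier := C l\<rparr>) \<AA>"
    and XC: "\<And>l \<sigma>. l \<in> \<Lambda> \<Longrightarrow> \<sigma> \<in> l \<Longrightarrow> X l \<sigma> \<subseteq> C l \<sigma> \<and> |C l \<sigma>| \<le>o \<kappa> l"
    by metis
  \<comment> \<open>Each sort of \<open>\<Sigma>\<close> lies in exactly one part, and
    \<open>D\<close> takes its carrier from the hull of that part. On other sorts \<open>D\<close>
    is unspecified.\<close>
  define D where "D \<sigma> = C (THE l. l \<in> \<Lambda> \<and> \<sigma> \<in> l) \<sigma>" for \<sigma>
  have D: "D \<sigma> = C l \<sigma>" if "l \<in> \<Lambda>" "\<sigma> \<in> l" for l \<sigma>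
  proof -
    have "(THE l. l \<in> \<Lambda> \<and> \<sigma> \<in> l) = l"
      using that part by (intro the_equality) (auto simp: partition_on_def disjoint_def)
    then show ?thesis by (simp add: D_def)
  qed
  have subS: "substructure (\<Sigma>s l) (\<AA>\<lparr>carrier := C l\<rparr>) \<AA>" if "l \<in> \<Lambda>" for l
    using C[OF that] unfolding elementary_substructure_def by (rule conjunct1)
  have strC: "is_structure (\<Sigma>s l) (\<AA>\<lparr>carrier := C l\<rparr>)" if "l \<in> \<Lambda>" for l
    using subS[OF that] unfolding substructure_def by (rule conjunct1)
  have subC: "C l \<sigma> \<subseteq> carrier \<AA> \<sigma>" if "l \<in> \<Lambda>" "\<sigma> \<in> l" for l \<sigma>
  proof -
    have "\<forall>\<sigma>\<in>sorts (\<Sigma>s l). carrier (\<AA>\<lparr>carrier := C l\<rparr>) \<sigma> \<subseteq> carrier \<AA> \<sigma>"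
      using subS[OF that(1)] unfolding substructure_def by (elim conjE)
    then show ?thesis using that(2) sorts[OF that(1)] by simp
  qed
  have subD: "D \<sigma> \<subseteq> carrier \<AA> \<sigma> \<and> D \<sigma> \<noteq> {}" if \<sigma>: "\<sigma> \<in> sorts \<Sigma>" for \<sigma>
  proof -
    obtain l where l: "l \<in> \<Lambda>" "\<sigma> \<in> l" using \<sigma> cover by blast
    then show ?thesis
      using subC[OF l] strC[OF l(1)] sorts[OF l(1)] by (simp add: D[OF l] is_structure_def)
  qed
  \<comment> \<open>All argument sorts of \<open>f\<close> and its result sort lie in one part, so
    closure is inherited from a single hull.\<close>
  have clos: "fun_int \<AA> f as \<in> D (fun_cod \<Sigma> f)"
    if f: "f \<in> funs \<Sigma>" and as: "as \<in> tuples (\<AA>\<lparr>carrier := D\<rparr>) (fun_dom \<Sigma> f)" for f as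
  proof -
    obtain l where l: "l \<in> \<Lambda>" "f \<in> funs (\<Sigma>s l)" using f funs by auto
    then have dom: "fun_dom (\<Sigma>s l) f = fun_dom \<Sigma> f" "fun_cod (\<Sigma>s l) f = fun_cod \<Sigma> f"
      using subsig by (auto simp: subsignature_def)
    then have in_l: "set (fun_dom \<Sigma> f) \<subseteq> l" "fun_cod \<Sigma> f \<in> l"
      using sigl l sorts by (fastforce simp: is_signature_def)+
    have "as \<in> tuples (\<AA>\<lparr>carrier := C l\<rparr>) (fun_dom \<Sigma> f)"
      using as in_l(1) D[OF l(1)] by (auto simp: tuples_def list_all2_conv_all_nth subset_iff)
    moreover have "\<forall>f\<in>funs (\<Sigma>s l). \<forall>as\<in>tuples (\<AA>\<lparr>carrier := C l\<rparr>) (fun_dom (\<Sigma>s l) f).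
        fun_int \<AA> f as \<in> C l (fun_cod (\<Sigma>s l) f)"
      using strC[OF l(1)] by (simp add: is_structure_def)
    ultimately show ?thesis
      using l(2) dom D[OF l(1) in_l(2)] by metis
  qed
  have "is_structure \<Sigma> (\<AA>\<lparr>carrier := D\<rparr>)"
    using str subD clos by (simp add: is_structure_def subset_iff)
  then have sub: "substructure \<Sigma> (\<AA>\<lparr>carrier := D\<rparr>) \<AA>"
    using str subD by (simp add: substructure_def)
  \<comment> \<open>A formula over \<open>\<Sigma>s l\<close> sees \<open>D\<close> only on the
    sorts in \<open>l\<close>, where it coincides with the hull \<open>C l\<close>.\<close>
  have local: "sat (\<AA>\<lparr>carrier := D\<rparr>) \<nu> \<psi> = sat \<AA> \<nu> \<psi>"
    if \<nu>: "is_assignment \<Sigma> (\<AA>\<lparr>carrier := D\<rparr>) \<nu>" and l: "l \<in> \<Lambda>" and \<psi>: "is_formula (\<Sigma>s l) \<psi>" for l \<psi> \<nu>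
  proof -
    have "is_assignment (\<Sigma>s l) (\<AA>\<lparr>carrier := C l\<rparr>) \<nu>"
      using \<nu> block[OF l] D[OF l] sorts[OF l] by (fastforce simp: is_assignment_def)
    then have "sat (\<AA>\<lparr>carrier := C l\<rparr>) \<nu> \<psi> = sat \<AA> \<nu> \<psi>"
      using C[OF l, unfolded elementary_substructure_def, THEN conjunct2] \<psi> by blast
    then show ?thesis
      using sat_carrier_cong[OF \<psi>, of D "C l"] D[OF l] sorts[OF l] by simp
  qed
  have "sat (\<AA>\<lparr>carrier := D\<rparr>) \<nu> \<phi> = sat \<AA> \<nu> \<phi>"
    if \<phi>: "is_formula \<Sigma> \<phi>" and \<nu>: "is_assignment \<Sigma> (\<AA>\<lparr>carrier := D\<rparr>) \<nu>" for \<phi> \<nu>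
  proof -
    \<comment> \<open>The determining formulas are compared in \<open>\<AA>\<close> and in its
      restriction to \<open>D\<close>, under the same \<open>\<nu>\<close>. Each is over a single
      part, so \<open>local\<close> gives the agreement.\<close>
    obtain \<Phi> where "\<forall>\<psi>\<in>\<Phi>. \<exists>l\<in>\<Lambda>. is_formula (\<Sigma>s l) \<psi>"
      "\<And>(M :: ('s, 'f, 'p, 'a) mstruct) (N :: ('s, 'f, 'p, 'a) mstruct) \<mu> \<nu>.
        \<forall>\<psi>\<in>\<Phi>. sat M \<mu> \<psi> = sat N \<nu> \<psi> \<Longrightarrow> sat M \<mu> \<phi> = sat N \<nu> \<phi>"
      using split_into_finitely_determined[OF split \<phi>] by metis
    with local[OF \<nu>] show ?thesis by meson
  qed
  with sub have "elementary_substructure \<Sigma> (\<AA>\<lparr>carrier := D\<rparr>) \<AA>"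
    unfolding elementary_substructure_def by blast
  moreover have "|D \<sigma>| =o \<kappa> l \<and> A \<sigma> \<subseteq> D \<sigma>" if l: "l \<in> \<Lambda>" and \<sigma>: "\<sigma> \<in> inf_sorts \<Sigma> \<AA> \<inter> l" for l \<sigma>
  proof -
    have "X l \<sigma> \<subseteq> C l \<sigma>" "|C l \<sigma>| \<le>o \<kappa> l" using XC[OF l] \<sigma> by auto
    moreover from this(1) have "\<kappa> l \<le>o |C l \<sigma>|"
      using Xinf[OF l \<sigma>] card_of_mono1 ordLeq_transitive by blast
    ultimately show ?thesis
      using Xinf[OF l \<sigma>] D[OF l] \<sigma> by (auto simp: ordIso_iff_ordLeq)
  qed
  moreover have "D \<sigma> = carrier \<AA> \<sigma>" if \<sigma>: "\<sigma> \<in> fin_sorts \<Sigma> \<AA>" for \<sigma>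
  proof -
    have "\<sigma> \<in> sorts \<Sigma>" using \<sigma> by (simp add: fin_sorts_def)
    then obtain l where l: "l \<in> \<Lambda>" "\<sigma> \<in> l" using cover by blast
    \<comment> \<open>The hull contains \<open>X l \<sigma>\<close>, which is already the full
      carrier.\<close>
    then show ?thesis
      using subC[OF l] XC[OF l] Xfin[OF l(1), of \<sigma>] \<sigma> D[OF l] by auto
  qed
  ultimately show ?thesis by (intro exI[of _ "\<AA>\<lparr>carrier := D\<rparr>"]) simp
qed

end
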